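(* Let $A$ be a ring and let $(\sigma,\delta)$ be a left skew derivation of $A$ such that $\sigma$ is an automorphism of $A$ and $\delta$ is locally nilpotent. Put $\sigma'=\sigma^{-1}$ and $\delta'=-\delta\sigma^{-1}$, and assume that there exists $m\ge 1$ such that $\delta'^m=0$. Then there is a unique ring structure on $A(\!(X)\!)$ (denoted $A(\!(X;\sigma,\delta)\!)$) containing $A[X;\sigma,\delta]$ as a subring and such that the multiplication obeys the rules $$sX^\ell=\sum_{i=0}^\infty s_iX^{i+\ell},$$ $$st=\sum_{n=0}^\infty\left[\left(\sum_{i=0}^{q_n}s_iX^i\right)\left(\sum_{i=0}^n t_iX^i\right)\right]_nX^n,$$ $$X^{-1}s=\sum_{k=0}^m\sigma'\delta'^k(s)X^{-1-k},$$ for all $\ell\in\mathbb Z$, all $s=\sum_{i\ge0}s_iX^i,\ t=\sum_{i\ge 0}t_iX^i\in A[\![X]\!]$, and all $q_n\ge\max_{0\le i\le n}\{O_n(t_i)\}$ ($n\in\mathbb N$). Here the product inside the square brackets is computed in $A[X;\sigma,\delta]$. Moreover, $A[\![X;\sigma,\delta]\!]$ is a subring of $A(\!(X;\sigma,\delta)\!)$.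
   Context: Rings are associative and unital. A left skew derivation of $A$ is a pair $(\sigma,\delta)$ where $\sigma$ is a ring endomorphism of $A$ and $\delta:A\to A$ is additive with $\delta(ab)=\sigma(a)\delta(b)+\delta(a)b$ for all $a,b\in A$. $A[X;\sigma,\delta]$ is the skew polynomial ring: the free left $A$-module $A[X]$ with basis $\{X^i:i\in\mathbb N\}$ and product determined by $X^iX^j=X^{i+j}$ and $Xa=\sigma(a)X+\delta(a)$. $A[\![X]\!]$ is the left $A$-module of formal power series $\sum_{i\ge0}s_iX^i$ and $A(\!(X)\!)$ the left $A$-module of formal Laurent series $\sum_{i\ge i_0}s_iX^i$ ($i_0\in\mathbb Z$), coefficients in $A$; $A[X]\subseteq A[\![X]\!]\subseteq A(\!(X)\!)$. A ring structure on one of these means a multiplication on its given additive group. For an additive map $L:A\to A$ and $s=\sum_i s_iX^i$ put $L(s)=\sum_iL(s_i)X^i$. $[f]_n$ or $(f)_n$ denotes the coefficient of $X^n$ in $f$. $\delta$ is locally nilpotent if for each $a\in A$ there is $k$ with $\delta^k(a)=0$. In this case, for every $a\in A$ and $n\in\mathbb N$ there exists a natural number, denoted $O_n(a)$, such that in $A[X;\sigma,\delta]$ one has $(X^ma)_i=0$ whenever $i\le n$ and $m\ge O_n(a)$. A ring structure on $A[\![X]\!]$ is reasonable if $A$ (constant series) is a subring, the coefficientwise left $A$-module structure of $A[\![X]\!]$ is left multiplication by elements of $A$, and $\left(\sum_{i\ge0}s_iX^i\right)X=\sum_{i\ge0}s_iX^{i+1}$ always. When $\delta$ is locally nilpotent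 there is a unique reasonable ring structure on $A[\![X]\!]$ containing $A[X;\sigma,\delta]$ as a subring; its product is the second formula displayed in the claim, and $A[\![X;\sigma,\delta]\!]$ denotes $A[\![X]\!]$ with this ring structure. *)

theory Defs
  imports "HOL-Computational_Algebra.Computational_Algebra"
begin

section \<open>Rings and ring structures\<close>

(* The coefficient ring has sort {ring, monoid_mult}: associative and unital, but
   unlike ring_1 this sort does not exclude the zero ring. *)
definition ring_structure :: "('b::ab_group_add \<Rightarrow> 'b \<Rightarrow> 'b) \<Rightarrow> bool" where
  "ring_structure M \<longleftrightarrow>
     (\<exists>e. monoid M e) \<and>
     (\<forall>x y z. M (x + y) z = M x z + M y z) \<and>
     (\<forall>x y z. M x (y + z) = M x y + M x z)"

(* (B, N) is a subring of (C, M) via the inclusion j; subrings share the identity. *)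
definition subring_via ::
  "('b::ab_group_add \<Rightarrow> 'c::ab_group_add) \<Rightarrow> ('b \<Rightarrow> 'b \<Rightarrow> 'b) \<Rightarrow> ('c \<Rightarrow> 'c \<Rightarrow> 'c) \<Rightarrow> bool" where
  "subring_via j N M \<longleftrightarrow>
     inj j \<and> additive j \<and>
     (\<forall>x y. j (N x y) = M (j x) (j y)) \<and>
     (\<exists>e. monoid N e \<and> monoid M (j e))"


section \<open>Skew derivations and skew polynomials\<close>

definition left_skew_derivation ::
  "('a::{ring,monoid_mult} \<Rightarrow> 'a) \<Rightarrow> ('a \<Rightarrow> 'a) \<Rightarrow> bool" where
  "left_skew_derivation \<sigma> \<delta> \<longleftrightarrow>
     additive \<sigma> \<and> (\<forall>a b. \<sigma> (a * b) = \<sigma> a * \<sigma> b) \<and> \<sigma> 1 = 1 \<and>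
     additive \<delta> \<and> (\<forall>a b. \<delta> (a * b) = \<sigma> a * \<delta> b + \<delta> a * b)"

definition locally_nilpotent :: "('a::zero \<Rightarrow> 'a) \<Rightarrow> bool" where
  "locally_nilpotent \<delta> \<longleftrightarrow> (\<forall>a. \<exists>k. (\<delta> ^^ k) a = 0)"

definition poly_lmult :: "'a::{ring,monoid_mult} \<Rightarrow> 'a poly \<Rightarrow> 'a poly" where
  "poly_lmult a p = map_poly (\<lambda>c. a * c) p"

(* X * (sum c_i X^i) = sum sigma(c_i) X^(i+1) + sum delta(c_i) X^i *)
definition skew_X_mult ::
  "('a::{ring,monoid_mult} \<Rightarrow> 'a) \<Rightarrow> ('a \<Rightarrow> 'a) \<Rightarrow> 'a poly \<Rightarrow> 'a poly" where
  "skew_X_mult \<sigma> \<delta> p = pCons 0 (map_poly \<sigma> p) + map_poly \<delta> p"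

(* The product of A[X; sigma, delta] on the left A-module 'a poly.  The theorem
   skew_mult_characterization below shows that this is the product determined by
   X^i X^j = X^(i+j) and X a = sigma(a) X + delta(a). *)
definition skew_mult ::
  "('a::{ring,monoid_mult} \<Rightarrow> 'a) \<Rightarrow> ('a \<Rightarrow> 'a) \<Rightarrow> 'a poly \<Rightarrow> 'a poly \<Rightarrow> 'a poly" where
  "skew_mult \<sigma> \<delta> p q =
     (\<Sum>i\<le>degree p. poly_lmult (coeff p i) ((skew_X_mult \<sigma> \<delta> ^^ i) q))"

(* Ob n a is a possible choice of the number O_n(a); existence of such a choice
   is skew_order_bound_exists below. *)
definition skew_order_bound ::
  "('a::{ring,monoid_mult} \<Rightarrow> 'a) \<Rightarrow> ('a \<Rightarrow> 'a) \<Rightarrow> (nat \<Rightarrow> 'a \<Rightarrow> nat) \<Rightarrow> bool" where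
  "skew_order_bound \<sigma> \<delta> Ob \<longleftrightarrow>
     (\<forall>n a m i. i \<le> n \<longrightarrow> Ob n a \<le> m \<longrightarrow>
        coeff (skew_mult \<sigma> \<delta> (monom 1 m) [:a:]) i = 0)"


section \<open>Skew power series\<close>

(* The product on 'a fps (and 'a fls) supplied by the library, in which X is central,
   is never used: a ring structure is always an explicit function M. *)

definition fps_map :: "('a \<Rightarrow> 'a) \<Rightarrow> 'a fps \<Rightarrow> 'a fps" where
  "fps_map L s = Abs_fps (\<lambda>i. L (fps_nth s i))"

definition reasonable ::
  "('a::{ring,monoid_mult} fps \<Rightarrow> 'a fps \<Rightarrow> 'a fps) \<Rightarrow> bool" where
  "reasonable M \<longleftrightarrow>
     ring_structure M \<and>
     subring_via fps_const (*) M \<and>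
     (\<forall>a s. M (fps_const a) s = fps_map (\<lambda>c. a * c) s) \<and>
     (\<forall>s. M s fps_X = Abs_fps (\<lambda>i. case i of 0 \<Rightarrow> 0 | Suc j \<Rightarrow> fps_nth s j))"

(* The product of A[[X; sigma, delta]], which is defined by its uniqueness; it is
   meaningful when delta is locally nilpotent. *)
definition skew_fps_mult ::
  "('a::{ring,monoid_mult} \<Rightarrow> 'a) \<Rightarrow> ('a \<Rightarrow> 'a) \<Rightarrow> 'a fps \<Rightarrow> 'a fps \<Rightarrow> 'a fps" where
  "skew_fps_mult \<sigma> \<delta> =
     (THE M. reasonable M \<and> subring_via fps_of_poly (skew_mult \<sigma> \<delta>) M)"


section \<open>Skew Laurent series\<close>

definition poly_to_fls :: "'a::zero poly \<Rightarrow> 'a fls" where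
  "poly_to_fls p = fps_to_fls (fps_of_poly p)"

(* sum s_i X^i with i \<ge> 0 is sent to sum s_i X^(i+l) *)
definition fps_shift_fls :: "int \<Rightarrow> 'a::zero fps \<Rightarrow> 'a fls" where
  "fps_shift_fls l s = fls_shift (- l) (fps_to_fls s)"

definition skew_sigma' :: "('a \<Rightarrow> 'a) \<Rightarrow> 'a \<Rightarrow> 'a" where
  "skew_sigma' \<sigma> = inv \<sigma>"

definition skew_delta' :: "('a \<Rightarrow> 'a) \<Rightarrow> ('a::uminus \<Rightarrow> 'a) \<Rightarrow> 'a \<Rightarrow> 'a" where
  "skew_delta' \<sigma> \<delta> a = - \<delta> (inv \<sigma> a)"

definition skew_laurent_structure ::
  "('a::{ring,monoid_mult} \<Rightarrow> 'a) \<Rightarrow> ('a \<Rightarrow> 'a) \<Rightarrow> (nat \<Rightarrow> 'a \<Rightarrow> nat) \<Rightarrow> nat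
     \<Rightarrow> ('a fls \<Rightarrow> 'a fls \<Rightarrow> 'a fls) \<Rightarrow> bool" where
  "skew_laurent_structure \<sigma> \<delta> Ob m M \<longleftrightarrow>
     ring_structure M \<and>
     subring_via poly_to_fls (skew_mult \<sigma> \<delta>) M \<and>
     (\<forall>s l. M (fps_to_fls s) (fls_X_intpow l) = fps_shift_fls l s) \<and>
     (\<forall>s t q. (\<forall>n. (MAX i\<in>{0..n}. Ob n (fps_nth t i)) \<le> q n) \<longrightarrow>
        M (fps_to_fls s) (fps_to_fls t) =
        fps_to_fls (Abs_fps (\<lambda>n.
          coeff (skew_mult \<sigma> \<delta> (\<Sum>i=0..q n. monom (fps_nth s i) i)
                               (\<Sum>i=0..n. monom (fps_nth t i) i)) n))) \<and>
     (\<forall>s. M (fls_X_intpow (-1)) (fps_to_fls s) =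
        (\<Sum>k=0..m. M (fps_to_fls (fps_map (skew_sigma' \<sigma> \<circ> (skew_delta' \<sigma> \<delta> ^^ k)) s))
                      (fls_X_intpow (- 1 - int k))))"


section \<open>Adequacy of the skew polynomial product and of the numbers \<open>O\<^sub>n(a)\<close>\<close>

context
  fixes \<sigma> \<delta> :: "'a::{ring,monoid_mult} \<Rightarrow> 'a"
  assumes sd: "left_skew_derivation \<sigma> \<delta>"
begin

lemma sg_add: "\<sigma> (a + b) = \<sigma> a + \<sigma> b" and dl_add: "\<delta> (a + b) = \<delta> a + \<delta> b"
  using sd by (simp_all add: left_skew_derivation_def additive.add)

lemma sg_0: "\<sigma> 0 = 0" and dl_0: "\<delta> 0 = 0"
  using sd by (simp_all add: left_skew_derivation_def additive.zero)

lemma sg_1: "\<sigma> 1 = 1" and dl_1: "\<delta> 1 = 0"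
proof -
  show "\<sigma> 1 = 1" using sd by (simp add: left_skew_derivation_def)
  moreover have "\<delta> (1 * 1) = \<sigma> 1 * \<delta> 1 + \<delta> 1 * 1"
    using sd unfolding left_skew_derivation_def by blast
  ultimately show "\<delta> 1 = 0" by simp
qed

lemma sg_mult: "\<sigma> (a * b) = \<sigma> a * \<sigma> b"
  and dl_mult: "\<delta> (a * b) = \<sigma> a * \<delta> b + \<delta> a * b"
  using sd by (simp_all add: left_skew_derivation_def)

lemma coeff_poly_lmult: "coeff (poly_lmult a p) i = a * coeff p i"
  by (simp add: poly_lmult_def coeff_map_poly)

lemma coeff_skew_X_mult:
  "coeff (skew_X_mult \<sigma> \<delta> p) i = (case i of 0 \<Rightarrow> 0 | Suc j \<Rightarrow> \<sigma> (coeff p j)) + \<delta> (coeff p i)"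
  by (simp add: skew_X_mult_def coeff_map_poly coeff_pCons sg_0 dl_0 split: nat.split)

lemma skew_X_mult_add: "skew_X_mult \<sigma> \<delta> (p + q) = skew_X_mult \<sigma> \<delta> p + skew_X_mult \<sigma> \<delta> q"
  by (rule poly_eqI) (simp add: coeff_skew_X_mult sg_add dl_add split: nat.split)

lemma skew_X_pow_add:
  "(skew_X_mult \<sigma> \<delta> ^^ n) (p + q) = (skew_X_mult \<sigma> \<delta> ^^ n) p + (skew_X_mult \<sigma> \<delta> ^^ n) q"
  by (induction n) (simp_all add: skew_X_mult_add)

lemma skew_X_mult_0: "skew_X_mult \<sigma> \<delta> 0 = 0"
  by (rule poly_eqI) (simp add: coeff_skew_X_mult sg_0 dl_0 split: nat.split)

lemma poly_lmult_add: "poly_lmult a (p + q) = poly_lmult a p + poly_lmult a q"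
  by (rule poly_eqI) (simp add: coeff_poly_lmult distrib_left)

lemma poly_lmult_add_left: "poly_lmult (a + b) p = poly_lmult a p + poly_lmult b p"
  by (rule poly_eqI) (simp add: coeff_poly_lmult distrib_right)

lemma poly_lmult_0: "poly_lmult a 0 = 0" "poly_lmult 0 p = 0" "poly_lmult 1 p = p"
  by (auto intro!: poly_eqI simp: coeff_poly_lmult)

lemma poly_lmult_assoc: "poly_lmult (a * b) p = poly_lmult a (poly_lmult b p)"
  by (rule poly_eqI) (simp add: coeff_poly_lmult mult.assoc)

lemma poly_lmult_sum: "poly_lmult a (sum f I) = (\<Sum>i\<in>I. poly_lmult a (f i))"
  by (induction I rule: infinite_finite_induct) (simp_all add: poly_lmult_0 poly_lmult_add)

lemma poly_lmult_monom: "poly_lmult a (monom b i) = monom (a * b) i"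
  by (rule poly_eqI) (simp add: coeff_poly_lmult)

lemma skew_X_mult_sum: "skew_X_mult \<sigma> \<delta> (sum f I) = (\<Sum>i\<in>I. skew_X_mult \<sigma> \<delta> (f i))"
  by (induction I rule: infinite_finite_induct) (simp_all add: skew_X_mult_0 skew_X_mult_add)

lemma skew_X_mult_lmult:
  "skew_X_mult \<sigma> \<delta> (poly_lmult a p) = poly_lmult (\<sigma> a) (skew_X_mult \<sigma> \<delta> p) + poly_lmult (\<delta> a) p"
  by (rule poly_eqI)
     (simp add: coeff_skew_X_mult coeff_poly_lmult sg_mult dl_mult algebra_simps split: nat.split)

lemma skew_mult_bound:
  assumes "degree p \<le> N"
  shows "skew_mult \<sigma> \<delta> p q = (\<Sum>i\<le>N. poly_lmult (coeff p i) ((skew_X_mult \<sigma> \<delta> ^^ i) q))"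
  unfolding skew_mult_def using assms
  by (intro sum.mono_neutral_left) (auto simp: poly_lmult_0 coeff_eq_0)

lemma skew_mult_add_left: "skew_mult \<sigma> \<delta> (p + p') q = skew_mult \<sigma> \<delta> p q + skew_mult \<sigma> \<delta> p' q"
proof -
  define N where "N = max (degree p) (degree p')"
  have "degree p \<le> N" "degree p' \<le> N" "degree (p + p') \<le> N"
    by (auto simp: N_def degree_add_le_max)
  then show ?thesis
    by (simp add: skew_mult_bound[where N = N] poly_lmult_add_left sum.distrib)
qed

lemma skew_mult_add_right: "skew_mult \<sigma> \<delta> p (q + q') = skew_mult \<sigma> \<delta> p q + skew_mult \<sigma> \<delta> p q'"
  by (simp add: skew_mult_def skew_X_pow_add poly_lmult_add sum.distrib)

lemma skew_mult_0: "skew_mult \<sigma> \<delta> 0 q = 0"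
  by (simp add: skew_mult_def poly_lmult_0)

lemma skew_mult_monom: "skew_mult \<sigma> \<delta> (monom a n) q = poly_lmult a ((skew_X_mult \<sigma> \<delta> ^^ n) q)"
proof -
  have "skew_mult \<sigma> \<delta> (monom a n) q =
        (\<Sum>i\<le>n. if i = n then poly_lmult a ((skew_X_mult \<sigma> \<delta> ^^ n) q) else 0)"
    unfolding skew_mult_bound[OF degree_monom_le]
    by (intro sum.cong) (auto simp: poly_lmult_0)
  then show ?thesis by simp
qed

lemma skew_mult_const: "skew_mult \<sigma> \<delta> [:a:] q = poly_lmult a q"
  using skew_mult_monom[of a 0 q] by (simp add: monom_0)

lemma skew_X_pow_monom: "(skew_X_mult \<sigma> \<delta> ^^ n) (monom 1 j) = monom 1 (n + j)"
  by (induction n)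
     (auto intro!: poly_eqI simp: coeff_skew_X_mult sg_0 sg_1 dl_0 dl_1 split: nat.split)

lemma skew_mult_monom_1: "skew_mult \<sigma> \<delta> (monom 1 n) q = (skew_X_mult \<sigma> \<delta> ^^ n) q"
  by (simp add: skew_mult_monom poly_lmult_0)

lemma skew_mult_lmult: "skew_mult \<sigma> \<delta> (poly_lmult a p) q = poly_lmult a (skew_mult \<sigma> \<delta> p q)"
proof -
  have "degree (poly_lmult a p) \<le> degree p"
    by (rule degree_le) (simp add: coeff_poly_lmult coeff_eq_0)
  then show ?thesis
    by (simp add: skew_mult_bound[where N = "degree p"] coeff_poly_lmult poly_lmult_assoc poly_lmult_sum)
qed

lemma skew_mult_sum: "skew_mult \<sigma> \<delta> (sum f I) q = (\<Sum>i\<in>I. skew_mult \<sigma> \<delta> (f i) q)"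
  by (induction I rule: infinite_finite_induct) (simp_all add: skew_mult_0 skew_mult_add_left)

lemma skew_X_mult_monom: "skew_X_mult \<sigma> \<delta> (monom a i) = monom (\<sigma> a) (Suc i) + monom (\<delta> a) i"
  by (rule poly_eqI) (auto simp: coeff_skew_X_mult sg_0 dl_0 split: nat.split)

lemma skew_mult_X_left: "skew_mult \<sigma> \<delta> (skew_X_mult \<sigma> \<delta> p) q = skew_X_mult \<sigma> \<delta> (skew_mult \<sigma> \<delta> p q)"
proof -
  have "skew_mult \<sigma> \<delta> (skew_X_mult \<sigma> \<delta> (monom a i)) q =
        skew_X_mult \<sigma> \<delta> (skew_mult \<sigma> \<delta> (monom a i) q)" for a i
    by (simp add: skew_X_mult_monom skew_mult_add_left skew_mult_monom skew_X_mult_lmult)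
  then have "skew_mult \<sigma> \<delta> (skew_X_mult \<sigma> \<delta> (\<Sum>i\<le>degree p. monom (coeff p i) i)) q =
        skew_X_mult \<sigma> \<delta> (skew_mult \<sigma> \<delta> (\<Sum>i\<le>degree p. monom (coeff p i) i) q)"
    by (simp add: skew_mult_sum skew_X_mult_sum)
  then show ?thesis by (simp add: poly_as_sum_of_monoms)
qed

lemma skew_mult_X_pow_left:
  "skew_mult \<sigma> \<delta> ((skew_X_mult \<sigma> \<delta> ^^ n) p) q = (skew_X_mult \<sigma> \<delta> ^^ n) (skew_mult \<sigma> \<delta> p q)"
  by (induction n) (simp_all add: skew_mult_X_left)

lemma skew_mult_assoc:
  "skew_mult \<sigma> \<delta> (skew_mult \<sigma> \<delta> p q) r = skew_mult \<sigma> \<delta> p (skew_mult \<sigma> \<delta> q r)"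
proof -
  have "skew_mult \<sigma> \<delta> (skew_mult \<sigma> \<delta> p q) r =
      (\<Sum>i\<le>degree p. skew_mult \<sigma> \<delta> (poly_lmult (coeff p i) ((skew_X_mult \<sigma> \<delta> ^^ i) q)) r)"
    by (simp add: skew_mult_def[of _ _ p] skew_mult_sum)
  also have "\<dots> = skew_mult \<sigma> \<delta> p (skew_mult \<sigma> \<delta> q r)"
    by (simp add: skew_mult_def[of _ _ p] skew_mult_lmult skew_mult_X_pow_left)
  finally show ?thesis .
qed

lemma skew_mult_one_right: "skew_mult \<sigma> \<delta> p [:1:] = p"
proof -
  have "skew_mult \<sigma> \<delta> p (monom 1 0) = (\<Sum>i\<le>degree p. monom (coeff p i) i)"
    by (simp add: skew_mult_def skew_X_pow_monom poly_lmult_monom)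
  then show ?thesis by (simp add: poly_as_sum_of_monoms monom_0)
qed

lemma monoid_skew_mult: "monoid (skew_mult \<sigma> \<delta>) [:1:]"
  by unfold_locales (simp_all add: skew_mult_assoc skew_mult_one_right skew_mult_const poly_lmult_0)

theorem skew_mult_characterization:
  "(ring_structure M \<and>
    (\<forall>a p. M [:a:] p = poly_lmult a p) \<and>
    (\<forall>i j. M (monom 1 i) (monom 1 j) = monom 1 (i + j)) \<and>
    (\<forall>a. M (monom 1 1) [:a:] = monom (\<sigma> a) 1 + [:\<delta> a:])) \<longleftrightarrow> M = skew_mult \<sigma> \<delta>"
proof
  assume "M = skew_mult \<sigma> \<delta>"
  moreover have "skew_X_mult \<sigma> \<delta> [:a:] = monom (\<sigma> a) (Suc 0) + [:\<delta> a:]" for a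
    using skew_X_mult_monom[of a 0] by (simp add: monom_0)
  ultimately show "ring_structure M \<and>
    (\<forall>a p. M [:a:] p = poly_lmult a p) \<and>
    (\<forall>i j. M (monom 1 i) (monom 1 j) = monom 1 (i + j)) \<and>
    (\<forall>a. M (monom 1 1) [:a:] = monom (\<sigma> a) 1 + [:\<delta> a:])"
    using monoid_skew_mult
    by (auto simp: ring_structure_def skew_mult_add_left skew_mult_add_right skew_mult_const
        skew_mult_monom_1 skew_X_pow_monom)
next
  assume "ring_structure M \<and>
    (\<forall>a p. M [:a:] p = poly_lmult a p) \<and>
    (\<forall>i j. M (monom 1 i) (monom 1 j) = monom 1 (i + j)) \<and>
    (\<forall>a. M (monom 1 1) [:a:] = monom (\<sigma> a) 1 + [:\<delta> a:])"
  then obtain e where mon: "monoid M e"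
    and addl: "\<And>x y z. M (x + y) z = M x z + M y z"
    and addr: "\<And>x y z. M x (y + z) = M x y + M x z"
    and lm: "\<And>a p. M [:a:] p = poly_lmult a p"
    and pw: "\<And>i j. M (monom 1 i) (monom 1 j) = monom 1 (i + j)"
    and Xa: "\<And>a. M (monom 1 1) [:a:] = monom (\<sigma> a) 1 + [:\<delta> a:]"
    unfolding ring_structure_def by blast
  have assoc: "M (M x y) z = M x (M y z)" for x y z
    using mon by (simp add: monoid_def semigroup_def)
  have z: "M 0 q = 0" "M p 0 = 0" for p q
    using addl[of 0 0 q] addr[of p 0 0] by simp_all
  have sl: "M (sum f I) q = (\<Sum>i\<in>I. M (f i) q)" for f :: "nat \<Rightarrow> _" and I q
    by (induction I rule: infinite_finite_induct) (simp_all add: z addl)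
  have sr: "M p (sum f I) = (\<Sum>i\<in>I. M p (f i))" for f :: "nat \<Rightarrow> _" and I p
    by (induction I rule: infinite_finite_induct) (simp_all add: z addr)
  have mono: "monom a i = M [:a:] (monom 1 i)" for a i
    by (simp add: lm poly_lmult_monom)
  have "M (monom 1 1) (monom a i) = skew_X_mult \<sigma> \<delta> (monom a i)" for a i
  proof -
    have "M (monom 1 1) (monom a i) = M (M (monom 1 1) [:a:]) (monom 1 i)"
      by (simp add: assoc mono[of a i])
    also have "\<dots> = M (M [:\<sigma> a:] (monom 1 1)) (monom 1 i) + M [:\<delta> a:] (monom 1 i)"
      by (simp only: Xa addl mono[of "\<sigma> a" 1])
    also have "\<dots> = M [:\<sigma> a:] (monom 1 (1 + i)) + M [:\<delta> a:] (monom 1 i)"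
      by (simp only: assoc pw)
    also have "\<dots> = skew_X_mult \<sigma> \<delta> (monom a i)"
      by (simp add: skew_X_mult_monom lm poly_lmult_monom)
    finally show ?thesis .
  qed
  then have "M (monom 1 1) (\<Sum>i\<le>degree p. monom (coeff p i) i) =
      skew_X_mult \<sigma> \<delta> (\<Sum>i\<le>degree p. monom (coeff p i) i)" for p
    by (simp only: sr skew_X_mult_sum)
  then have X: "M (monom 1 1) p = skew_X_mult \<sigma> \<delta> p" for p
    by (simp add: poly_as_sum_of_monoms)
  have one: "M (monom 1 0) q = q" for q
    by (simp add: monom_0 lm poly_lmult_0)
  have Xn: "M (monom 1 n) q = (skew_X_mult \<sigma> \<delta> ^^ n) q" for n q
  proof (induction n)
    case 0
    then show ?case by (simp only: one funpow_0)
  next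
    case (Suc n)
    have "M (monom 1 (Suc n)) q = M (monom 1 1) (M (monom 1 n) q)"
      using pw[of 1 n] assoc[of "monom 1 1" "monom 1 n" q] by simp
    then show ?case by (simp only: X Suc funpow.simps o_apply)
  qed
  have "M p q = skew_mult \<sigma> \<delta> p q" for p q
  proof -
    have "M (monom a i) q = M [:a:] (M (monom 1 i) q)" for a i
      using assoc[of "[:a:]" "monom 1 i" q] by (simp only: mono[of a i])
    then have "M (\<Sum>i\<le>degree p. monom (coeff p i) i) q =
        (\<Sum>i\<le>degree p. M [:coeff p i:] (M (monom 1 i) q))"
      unfolding sl by (intro sum.cong refl)
    then show ?thesis by (simp add: poly_as_sum_of_monoms skew_mult_def lm Xn)
  qed
  then show "M = skew_mult \<sigma> \<delta>" by (intro ext)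
qed

theorem skew_order_bound_exists:
  assumes "locally_nilpotent \<delta>"
  shows "\<exists>Ob. skew_order_bound \<sigma> \<delta> Ob"
proof -
  let ?c = "\<lambda>a m i. coeff ((skew_X_mult \<sigma> \<delta> ^^ m) [:a:]) i"
  have d0: "(\<delta> ^^ k) 0 = 0" for k
    by (induction k) (simp_all add: dl_0)
  have step: "\<exists>N'. \<forall>m\<ge>N'. ?c a m i = 0"
    if N: "\<And>m j. m \<ge> N \<Longrightarrow> j < i \<Longrightarrow> ?c a m j = 0" for a i N
  proof -
    have run: "?c a (N + k) i = (\<delta> ^^ k) (?c a N i)" for k
      by (induction k) (use N in \<open>auto simp: coeff_skew_X_mult sg_0 split: nat.split\<close>)
    obtain k where "(\<delta> ^^ k) (?c a N i) = 0"
      using assms unfolding locally_nilpotent_def by blast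
    then have "(\<delta> ^^ (l + k)) (?c a N i) = 0" for l
      by (simp add: funpow_add d0)
    then have z: "?c a (N + (l + k)) i = 0" for l
      by (simp only: run)
    have "?c a m i = 0" if "N + k \<le> m" for m
    proof -
      from that obtain l where "m = N + k + l" by (rule less_eqE)
      then have "m = N + (l + k)" by simp
      with z[of l] show ?thesis by simp
    qed
    then show ?thesis by blast
  qed
  have low: "\<exists>N. \<forall>m\<ge>N. \<forall>j<i. ?c a m j = 0" for a i
  proof (induction i)
    case 0
    then show ?case by simp
  next
    case (Suc i)
    then obtain N where N: "\<And>m j. m \<ge> N \<Longrightarrow> j < i \<Longrightarrow> ?c a m j = 0" by blast
    from step[OF this] obtain N' where "\<And>m. m \<ge> N' \<Longrightarrow> ?c a m i = 0" by blast
    with N have "\<forall>m\<ge>max N N'. \<forall>j<Suc i. ?c a m j = 0" by (auto simp: less_Suc_eq)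
    then show ?case by blast
  qed
  then have "\<forall>n a. \<exists>N. \<forall>m\<ge>N. \<forall>j<Suc n. ?c a m j = 0" by blast
  then obtain Ob where "\<forall>n a. \<forall>m\<ge>Ob n a. \<forall>j<Suc n. ?c a m j = 0" by metis
  then have "skew_order_bound \<sigma> \<delta> Ob"
    by (auto simp: skew_order_bound_def skew_mult_monom_1 less_Suc_eq_le)
  then show ?thesis by blast
qed

end

end

theory Submission
  imports Defs
begin

text \<open>
  On Laurent series put \<open>T f = \<sigma>(f) X + \<delta>(f)\<close>, with \<open>\<sigma>\<close>, \<open>\<delta>\<close> applied to coefficients. The operator
  \<open>f \<mapsto> \<Sum>\<^sub>k \<sigma>'\<delta>'\<^sup>k(f) X\<^sup>-\<^sup>1\<^sup>-\<^sup>k\<close> is its two-sided inverse, because the compositions telescope and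
  \<open>\<delta>'\<close> is nilpotent. The product is \<open>f g = \<Sum>\<^sub>i f\<^sub>i T\<^sup>i(g)\<close> with \<open>i\<close> running over the integers: local
  nilpotency of \<open>\<delta>\<close> makes each coefficient a finite sum. Since \<open>T\<close> commutes with right
  multiplications, \<open>T\<^sup>i(g h) = T\<^sup>i(g) h\<close>, and associativity is an exchange of finite sums.

  For uniqueness, the rules force right multiplication by \<open>X\<^sup>j\<close> to be the shift and left
  multiplication by \<open>X\<^sup>-\<^sup>1\<close> to be \<open>T\<^sup>-\<^sup>1\<close>; writing \<open>f = s X\<^sup>-\<^sup>n\<close> and \<open>T\<^sup>-\<^sup>n(g) = t X\<^sup>-\<^sup>k\<close> with power series
  \<open>s\<close>, \<open>t\<close> gives \<open>f g = (s t) X\<^sup>-\<^sup>k\<close>. A reasonable product of power series is determined by truncating both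
  factors, since multiples of high powers of \<open>X\<close> do not contribute to a given coefficient.
\<close>

unbundle fps_syntax

section \<open>Coefficients of Laurent series and of embedded polynomials\<close>

lemma fls_nth_sum: "sum f I $$ n = (\<Sum>i\<in>I. f i $$ n)"
  for f :: "'b \<Rightarrow> 'a::ab_group_add fls"
  by (induction I rule: infinite_finite_induct) simp_all

text \<open>A large enough power of X clears the negative terms. The exponent is natural, and 0 if
  there are no such terms, so that products with it can be treated by induction.\<close>

lemma fls_eq_shift_fps_to_fls:
  fixes f :: "'a::zero fls"
  obtains n s where "f = fls_shift (int n) (fps_to_fls s)"
proof
  show "f = fls_shift (int (nat (- fls_subdegree f)))
    (fps_to_fls (fls_regpart (fls_shift (- int (nat (- fls_subdegree f))) f)))"
    by (rule fls_eqI) auto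
qed

lemma poly_to_fls_nth: "poly_to_fls p $$ n = (if n < 0 then 0 else coeff p (nat n))"
  by (simp add: poly_to_fls_def)

lemma poly_to_fls_one: "poly_to_fls [:1:] = 1"
  by (rule fls_eqI) (auto simp: poly_to_fls_nth coeff_pCons split: nat.split)

section \<open>Standing hypotheses and the maps \<sigma>' and \<delta>'\<close>

locale nilpotent_skew_derivation =
  fixes \<sigma> \<delta> :: "'a::{ring,monoid_mult} \<Rightarrow> 'a" and m :: nat
  assumes skew_derivation: "left_skew_derivation \<sigma> \<delta>"
    and bij_sigma: "bij \<sigma>"
    and nilpotent_delta: "locally_nilpotent \<delta>"
    and nilpotent_delta': "\<forall>a. (skew_delta' \<sigma> \<delta> ^^ m) a = 0"
begin

abbreviation "\<sigma>' \<equiv> skew_sigma' \<sigma>"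
abbreviation "\<delta>' \<equiv> skew_delta' \<sigma> \<delta>"

lemmas sigma_simps = sg_add[OF skew_derivation] sg_mult[OF skew_derivation]
  sg_0[OF skew_derivation] sg_1[OF skew_derivation]
lemmas delta_simps = dl_add[OF skew_derivation] dl_mult[OF skew_derivation]
  dl_0[OF skew_derivation] dl_1[OF skew_derivation]

lemma sigma_sum: "\<sigma> (sum f I) = (\<Sum>i\<in>I. \<sigma> (f i))"
  by (induction I rule: infinite_finite_induct) (simp_all add: sigma_simps)

lemma delta_sum: "\<delta> (sum f I) = (\<Sum>i\<in>I. \<delta> (f i))"
  by (induction I rule: infinite_finite_induct) (simp_all add: delta_simps)

lemma sigma_sigma': "\<sigma> (\<sigma>' a) = a"
  by (simp add: skew_sigma'_def bij_is_surj[OF bij_sigma] surj_f_inv_f)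

lemma sigma'_sigma: "\<sigma>' (\<sigma> a) = a"
  by (simp add: skew_sigma'_def bij_is_inj[OF bij_sigma])

lemma sigma'_add: "\<sigma>' (a + b) = \<sigma>' a + \<sigma>' b"
  by (metis sg_add[OF skew_derivation] sigma_sigma' sigma'_sigma)

lemma sigma'_0: "\<sigma>' 0 = 0"
  by (metis sigma_simps(3) sigma'_sigma)

lemma delta'_conv: "\<delta>' a = - \<delta> (\<sigma>' a)"
  by (simp add: skew_delta'_def skew_sigma'_def)

lemma delta'_add: "\<delta>' (a + b) = \<delta>' a + \<delta>' b"
  by (simp add: delta'_conv sigma'_add delta_simps)

lemma delta'_0: "\<delta>' 0 = 0"
  by (simp add: delta'_conv sigma'_0 delta_simps)

lemma delta'_pow_add: "(\<delta>' ^^ k) (a + b) = (\<delta>' ^^ k) a + (\<delta>' ^^ k) b"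
  by (induction k) (simp_all add: delta'_add)

lemma delta'_pow_0: "(\<delta>' ^^ k) 0 = 0"
  by (induction k) (simp_all add: delta'_0)

lemma delta_pow_0: "(\<delta> ^^ k) 0 = 0"
  by (induction k) (simp_all add: delta_simps)

text \<open>Expressing \<delta> through \<delta>', here and in \<open>delta_eq\<close>, is what
  makes the compositions of \<open>X_mult\<close> and \<open>X_inv_mult\<close> telescope.\<close>

lemma delta_sigma': "\<delta> (\<sigma>' a) = - \<delta>' a"
  by (simp add: delta'_conv)

lemma delta_eq: "\<delta> a = - \<delta>' (\<sigma> a)"
  by (simp add: delta'_conv sigma'_sigma)


section \<open>Left multiplication by powers of X\<close>

definition X_mult :: "'a fls \<Rightarrow> 'a fls" where
  "X_mult f = Abs_fls (\<lambda>n. \<sigma> (f $$ (n - 1)) + \<delta> (f $$ n))"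

text \<open>Coefficientwise form of the right side of the third rule: the factor X^(-1-k) moves the
  coefficient of X^(n+1+k) to X^n.\<close>

definition X_inv_mult :: "'a fls \<Rightarrow> 'a fls" where
  "X_inv_mult f = Abs_fls (\<lambda>n. \<Sum>k=0..m. \<sigma>' ((\<delta>' ^^ k) (f $$ (n + 1 + int k))))"

definition X_pow_mult :: "int \<Rightarrow> 'a fls \<Rightarrow> 'a fls" where
  "X_pow_mult i = (if 0 \<le> i then X_mult ^^ nat i else X_inv_mult ^^ nat (- i))"

lemma X_mult_nth: "X_mult f $$ n = \<sigma> (f $$ (n - 1)) + \<delta> (f $$ n)"
proof -
  obtain N where "\<forall>n<N. f $$ n = 0" by (rule fls_nth_vanishes_belowE)
  then show ?thesis unfolding X_mult_def
    by (intro nth_Abs_fls_lower_bound[of N]) (simp add: sigma_simps delta_simps)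
qed

lemma X_inv_mult_nth:
  "X_inv_mult f $$ n = (\<Sum>k=0..m. \<sigma>' ((\<delta>' ^^ k) (f $$ (n + 1 + int k))))"
proof -
  obtain N where "\<forall>n<N. f $$ n = 0" by (rule fls_nth_vanishes_belowE)
  then show ?thesis unfolding X_inv_mult_def
    \<comment> \<open>Summand k lowers degrees by 1 + k, hence by at most m + 1.\<close>
    by (intro nth_Abs_fls_lower_bound[of "N - 1 - int m"])
       (auto simp: sigma'_0 delta'_pow_0 intro!: sum.neutral)
qed

text \<open>In degree n - 1 the map \<sigma> undoes \<sigma>' and leaves \<delta>'^k, while \<delta>
  \<sigma>' in degree n gives -\<delta>'^(k+1); consecutive terms cancel.\<close>

lemma X_mult_X_inv_mult: "X_mult (X_inv_mult f) = f"
proof (rule fls_eqI)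
  fix n
  let ?c = "\<lambda>k. (\<delta>' ^^ k) (f $$ (n + int k))"
  have "X_mult (X_inv_mult f) $$ n = (\<Sum>k=0..m. ?c k - ?c (Suc k))"
    by (simp add: X_mult_nth X_inv_mult_nth sigma_sum delta_sum sigma_sigma' delta_sigma'
        sum_subtractf sum_negf add.assoc)
  also have "\<dots> = ?c 0 - ?c (Suc m)"
    using sum_telescope[of ?c m] by (simp add: atMost_atLeast0)
  also have "?c (Suc m) = 0"
    using nilpotent_delta' by (simp add: delta'_0)
  finally show "X_mult (X_inv_mult f) $$ n = f $$ n" by simp
qed

lemma delta'_pow_diff: "(\<delta>' ^^ k) (a - b) = (\<delta>' ^^ k) a - (\<delta>' ^^ k) b"
  using delta'_pow_add[of k "a - b" b] by simp

lemma sigma'_diff: "\<sigma>' (a - b) = \<sigma>' a - \<sigma>' b"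
  using sigma'_add[of "a - b" b] by simp

text \<open>The \<delta> part of summand k cancels the \<sigma> part of summand k + 1.\<close>

lemma X_inv_mult_X_mult: "X_inv_mult (X_mult f) = f"
proof (rule fls_eqI)
  fix n
  let ?c = "\<lambda>k. \<sigma>' ((\<delta>' ^^ k) (\<sigma> (f $$ (n + int k))))"
  have "\<sigma>' ((\<delta>' ^^ k) (X_mult f $$ (n + 1 + int k))) = ?c k - ?c (Suc k)" for k
  proof -
    have "X_mult f $$ (n + 1 + int k) = \<sigma> (f $$ (n + int k)) - \<delta>' (\<sigma> (f $$ (n + int (Suc k))))"
      by (simp add: X_mult_nth delta_eq add.assoc)
    then show ?thesis
      by (simp add: delta'_pow_diff sigma'_diff funpow_swap1 del: of_nat_Suc)
  qed
  then have "X_inv_mult (X_mult f) $$ n = (\<Sum>k=0..m. ?c k - ?c (Suc k))"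
    by (simp add: X_inv_mult_nth)
  also have "\<dots> = ?c 0 - ?c (Suc m)"
    using sum_telescope[of ?c m] by (simp add: atMost_atLeast0)
  also have "?c (Suc m) = 0"
    using nilpotent_delta' by (simp add: delta'_0 sigma'_0)
  finally show "X_inv_mult (X_mult f) $$ n = f $$ n" by (simp add: sigma'_sigma)
qed

lemma X_mult_pow: "X_mult (X_pow_mult i f) = X_pow_mult (i + 1) f"
proof (cases "0 \<le> i")
  case True
  then show ?thesis by (simp add: X_pow_mult_def nat_add_distrib)
next
  case False
  \<comment> \<open>One \<open>X_inv_mult\<close> is split off for \<open>X_mult\<close> to cancel;
    the remaining exponent is 0 when i = -1.\<close>
  then have "nat (- i) = Suc (nat (- i - 1))" by simp
  then have "X_mult (X_pow_mult i f) = (X_inv_mult ^^ nat (- i - 1)) f"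
    using False by (simp add: X_pow_mult_def X_mult_X_inv_mult)
  then show ?thesis using False by (auto simp: X_pow_mult_def)
qed

lemma X_mult_add: "X_mult (f + g) = X_mult f + X_mult g"
  by (rule fls_eqI) (simp add: X_mult_nth sigma_simps delta_simps)

lemma X_inv_mult_add: "X_inv_mult (f + g) = X_inv_mult f + X_inv_mult g"
  by (rule fls_eqI) (simp add: X_inv_mult_nth sigma'_add delta'_pow_add sum.distrib)

lemma X_pow_mult_add: "X_pow_mult i (f + g) = X_pow_mult i f + X_pow_mult i g"
proof -
  have "(X_mult ^^ n) (f + g) = (X_mult ^^ n) f + (X_mult ^^ n) g"
    "(X_inv_mult ^^ n) (f + g) = (X_inv_mult ^^ n) f + (X_inv_mult ^^ n) g" for n
    by (induction n) (simp_all add: X_mult_add X_inv_mult_add)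
  then show ?thesis by (simp add: X_pow_mult_def)
qed

text \<open>\<open>fls_shift j 1\<close> is X^(-j). Its coefficients are 0 and 1, where \<sigma>(1)
  = 1 and \<delta>(1) = 0.\<close>

lemma X_mult_intpow: "X_mult (fls_shift j 1) = fls_shift (j - 1) 1"
  by (rule fls_eqI) (auto simp: X_mult_nth sigma_simps delta_simps)

lemma X_inv_mult_intpow: "X_inv_mult (fls_shift j 1) = fls_shift (j + 1) 1"
  using X_inv_mult_X_mult[of "fls_shift (j + 1) 1"] by (simp add: X_mult_intpow)

lemma X_pow_mult_intpow: "X_pow_mult i (fls_shift j 1) = fls_shift (j - i) 1"
proof -
  have "(X_mult ^^ n) (fls_shift j 1) = fls_shift (j - int n) 1"
    "(X_inv_mult ^^ n) (fls_shift j 1) = fls_shift (j + int n) 1" for n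
    by (induction n) (simp_all add: X_mult_intpow X_inv_mult_intpow diff_diff_eq add_ac)
  then show ?thesis by (simp add: X_pow_mult_def)
qed

section \<open>Degree bounds for powers of X acting on a series\<close>

lemma X_pow_mult_vanishes_below:
  assumes "0 \<le> i" "\<And>n. n < d \<Longrightarrow> f $$ n = 0" "n < d"
  shows "X_pow_mult i f $$ n = 0"
proof -
  have "(X_mult ^^ k) f $$ n = 0" if "n < d" for n k
    using that
    by (induction k arbitrary: n) (simp_all add: assms(2) X_mult_nth sigma_simps delta_simps)
  with assms(1,3) show ?thesis by (simp add: X_pow_mult_def)
qed

text \<open>Nonnegative powers never lower the degree, and each inverse lowers it by at most m + 1.
  Only finitely many negative i satisfy a \<le> i, so one bound serves all i.\<close>

lemma X_pow_mult_lower_bound: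
  obtains c where "\<And>i n. a \<le> i \<Longrightarrow> n < c \<Longrightarrow> X_pow_mult i f $$ n = 0"
proof -
  obtain d where d: "\<forall>n<d. f $$ n = 0" by (rule fls_nth_vanishes_belowE)
  have neg: "(X_inv_mult ^^ k) f $$ n = 0" if "n < d - int k * (int m + 1)" for n k
    using that
  proof (induction k arbitrary: n)
    case (Suc k)
    then have "(X_inv_mult ^^ k) f $$ (n + 1 + int j) = 0" if "j \<le> m" for j
      using that by (intro Suc.IH) (simp add: algebra_simps)
    then show ?case by (auto simp: X_inv_mult_nth delta'_pow_0 sigma'_0 intro!: sum.neutral)
  qed (use d in simp)
  show thesis
  proof (rule that)
    fix i n assume *: "a \<le> i" "n < d - int (nat (- a)) * (int m + 1)"
    show "X_pow_mult i f $$ n = 0"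
    proof (cases "0 \<le> i")
      case True
      have "0 \<le> int (nat (- a)) * (int m + 1)" by simp
      with * have "n < d" by linarith
      with True d show ?thesis by (intro X_pow_mult_vanishes_below[where d = d]) auto
    next
      case False
      with * have "int (nat (- i)) * (int m + 1) \<le> int (nat (- a)) * (int m + 1)"
        by (intro mult_right_mono) auto
      with * have "n < d - int (nat (- i)) * (int m + 1)" by linarith
      from neg[OF this] show ?thesis using False by (simp add: X_pow_mult_def)
    qed
  qed
qed

text \<open>Makes the sums in the product finite. The induction runs over degrees: once all lower
  coefficients of \<open>X_pow_mult i f\<close> vanish for large i, passing to i + 1 merely applies
  \<delta> to the next one, and local nilpotency kills it.\<close>

lemma X_pow_mult_upper_bound:
  obtains b where "\<And>i n'. b < i \<Longrightarrow> n' \<le> n \<Longrightarrow> X_pow_mult i f $$ n' = 0"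
proof -
  obtain d where d: "\<forall>n<d. f $$ n = 0" by (rule fls_nth_vanishes_belowE)
  have "\<exists>b. \<forall>i>b. \<forall>n' < d + int k. X_pow_mult i f $$ n' = 0" for k
  proof (induction k)
    case 0
    show ?case using d by (intro exI[of _ 0]) (auto intro: X_pow_mult_vanishes_below)
  next
    case (Suc k)
    then obtain b where b: "\<And>i n'. b < i \<Longrightarrow> n' < d + int k \<Longrightarrow> X_pow_mult i f $$ n' = 0"
      by blast
    define c where "c = X_pow_mult (b + 1) f $$ (d + int k)"
    have run: "X_pow_mult (b + 1 + int j) f $$ (d + int k) = (\<delta> ^^ j) c" for j
    proof (induction j)
      case (Suc j)
      have "X_pow_mult (b + 1 + int (Suc j)) f = X_mult (X_pow_mult (b + 1 + int j) f)"
        by (simp add: X_mult_pow algebra_simps)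
      with Suc show ?case by (simp add: X_mult_nth b sigma_simps)
    qed (simp add: c_def)
    obtain l where l: "(\<delta> ^^ l) c = 0"
      using nilpotent_delta unfolding locally_nilpotent_def by blast
    have "X_pow_mult i f $$ n' = 0" if "b + 1 + int l < i" "n' < d + int (Suc k)" for i n'
    proof (cases "n' < d + int k")
      case True
      with that show ?thesis by (intro b) auto
    next
      case False
      with that have n': "n' = d + int k" by simp
      define j where "j = nat (i - b - 1 - int l)"
      have "i = b + 1 + int (j + l)" using that by (simp add: j_def)
      then show ?thesis unfolding n' by (simp only: run funpow_add o_apply l delta_pow_0)
    qed
    then show ?case by blast
  qed
  \<comment> \<open>With this k, d + k exceeds n.\<close>
  from this[of "nat (n - d + 1)"] obtain b where
    "\<forall>i>b. \<forall>n' < d + int (nat (n - d + 1)). X_pow_mult i f $$ n' = 0" by blast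
  then show thesis by (intro that[of b]) auto
qed

section \<open>The product of Laurent series\<close>

text \<open>The coefficient of X^n in the formal sum of \<open>f $$ i\<close> times
  \<open>X_pow_mult i g\<close> over all integers i. The upper limit is an arbitrary choice, on
  which the value does not depend by \<open>skew_fls_mult_nth\<close>.\<close>

definition skew_fls_mult :: "'a fls \<Rightarrow> 'a fls \<Rightarrow> 'a fls" where
  "skew_fls_mult f g = Abs_fls (\<lambda>n.
     \<Sum>i=fls_subdegree f..(SOME b. \<forall>i>b. \<forall>n'\<le>n. X_pow_mult i g $$ n' = 0).
       f $$ i * X_pow_mult i g $$ n)"

text \<open>Adding or dropping vanishing summands does not change the sum. This allows several
  products to be expanded over a common range.\<close>

lemma skew_fls_mult_nth:
  assumes a: "\<And>i. i < a \<Longrightarrow> f $$ i = 0"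
    and b: "\<And>i. b < i \<Longrightarrow> X_pow_mult i g $$ n = 0"
  shows "skew_fls_mult f g $$ n = (\<Sum>i=a..b. f $$ i * X_pow_mult i g $$ n)"
proof -
  define B where "B n = (SOME b. \<forall>i>b. \<forall>n'\<le>n. X_pow_mult i g $$ n' = 0)" for n
  have B: "X_pow_mult i g $$ n' = 0" if "B n < i" "n' \<le> n" for i n n'
  proof -
    have "\<exists>b. \<forall>i>b. \<forall>n'\<le>n. X_pow_mult i g $$ n' = 0"
      by (metis X_pow_mult_upper_bound)
    from someI_ex[OF this] that show ?thesis unfolding B_def by blast
  qed
  obtain c where c: "\<And>i n. fls_subdegree f \<le> i \<Longrightarrow> n < c \<Longrightarrow> X_pow_mult i g $$ n = 0"
    using X_pow_mult_lower_bound[where f = g and a = "fls_subdegree f"] by blast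
  have "skew_fls_mult f g $$ n = (\<Sum>i=fls_subdegree f..B n. f $$ i * X_pow_mult i g $$ n)"
    unfolding skew_fls_mult_def B_def[symmetric]
    by (intro nth_Abs_fls_lower_bound[of c]) (auto intro!: sum.neutral simp: c)
  \<comment> \<open>Neither range need contain the other, so they are compared through their
    union.\<close>
  also have "\<dots> = (\<Sum>i\<in>{fls_subdegree f..B n} \<union> {a..b}. f $$ i * X_pow_mult i g $$ n)"
    by (rule sum.mono_neutral_left) (auto simp: not_le B)
  also have "\<dots> = (\<Sum>i=a..b. f $$ i * X_pow_mult i g $$ n)"
    by (rule sum.mono_neutral_right) (auto simp: not_le a b)
  finally show ?thesis .
qed

lemma skew_fls_mult_add_left:
  "skew_fls_mult (f + f') g = skew_fls_mult f g + skew_fls_mult f' g"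
proof (rule fls_eqI)
  fix n
  obtain b where b: "\<And>i n'. b < i \<Longrightarrow> n' \<le> n \<Longrightarrow> X_pow_mult i g $$ n' = 0"
    using X_pow_mult_upper_bound[where f = "g" and n = n] by blast
  define a where "a = min (fls_subdegree f) (fls_subdegree f')"
  have "\<And>i. i < a \<Longrightarrow> f $$ i = 0" "\<And>i. i < a \<Longrightarrow> f' $$ i = 0"
    by (auto simp: a_def)
  then show "skew_fls_mult (f + f') g $$ n = (skew_fls_mult f g + skew_fls_mult f' g) $$ n"
    by (simp add: skew_fls_mult_nth[of a _ b] b distrib_right sum.distrib)
qed

lemma skew_fls_mult_add_right:
  "skew_fls_mult f (g + g') = skew_fls_mult f g + skew_fls_mult f g'"
proof (rule fls_eqI)
  fix n
  obtain b where b: "\<And>i n'. b < i \<Longrightarrow> n' \<le> n \<Longrightarrow> X_pow_mult i g $$ n' = 0"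
    using X_pow_mult_upper_bound[where f = "g" and n = n] by blast
  obtain b' where b': "\<And>i n'. b' < i \<Longrightarrow> n' \<le> n \<Longrightarrow> X_pow_mult i g' $$ n' = 0"
    using X_pow_mult_upper_bound[where f = "g'" and n = n] by blast
  show "skew_fls_mult f (g + g') $$ n = (skew_fls_mult f g + skew_fls_mult f g') $$ n"
    by (simp add: skew_fls_mult_nth[of "fls_subdegree f" _ "max b b'"] b b' X_pow_mult_add
        distrib_left sum.distrib)
qed

text \<open>By the skew Leibniz rule, the terms with \<sigma>(f_i) combine to \<sigma>(f_i) times a
  coefficient of X^(i+1) g; replacing i + 1 by i gives the \<sigma> part of X f.\<close>

lemma X_mult_skew_fls_mult: "X_mult (skew_fls_mult f g) = skew_fls_mult (X_mult f) g"
proof (rule fls_eqI)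
  fix n
  obtain b where b: "\<And>i n'. b < i \<Longrightarrow> n' \<le> n \<Longrightarrow> X_pow_mult i g $$ n' = 0"
    using X_pow_mult_upper_bound[where f = "g" and n = n] by blast
  define a where "a = fls_subdegree f"
  have a: "\<And>i. i < a \<Longrightarrow> f $$ i = 0" by (simp add: a_def)
  let ?c = "\<lambda>i. X_pow_mult i g"
  have c: "?c (i + 1) $$ n = \<sigma> (?c i $$ (n - 1)) + \<delta> (?c i $$ n)" for i
    by (simp add: X_mult_pow[symmetric] X_mult_nth)
  have "X_mult (skew_fls_mult f g) $$ n =
      (\<Sum>i=a..b. \<sigma> (f $$ i) * \<sigma> (?c i $$ (n - 1))) +
      (\<Sum>i=a..b. \<sigma> (f $$ i) * \<delta> (?c i $$ n) + \<delta> (f $$ i) * ?c i $$ n)"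
    by (simp add: X_mult_nth skew_fls_mult_nth[of a _ b] a b sigma_sum delta_sum
        sigma_simps delta_simps)
  also have "\<dots> = (\<Sum>i=a..b. \<sigma> (f $$ i) * ?c (i + 1) $$ n) + (\<Sum>i=a..b. \<delta> (f $$ i) * ?c i $$ n)"
    by (simp add: c distrib_left sum.distrib add_ac)
  also have "(\<Sum>i=a..b. \<sigma> (f $$ i) * ?c (i + 1) $$ n) =
      (\<Sum>i=a+1..b+1. \<sigma> (f $$ (i - 1)) * ?c i $$ n)"
    by (rule sum.reindex_bij_witness[of _ "\<lambda>i. i - 1" "\<lambda>i. i + 1"]) auto
  \<comment> \<open>Both sums are extended to a common range: f_(a-1) = 0 at the lower end, and
    \<open>?c (b + 1) $$ n\<close> is 0 at the upper one.\<close>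
  also have "\<dots> = (\<Sum>i=a..b+1. \<sigma> (f $$ (i - 1)) * ?c i $$ n)"
    by (rule sum.mono_neutral_left) (auto simp: a sigma_simps)
  also have "(\<Sum>i=a..b. \<delta> (f $$ i) * ?c i $$ n) = (\<Sum>i=a..b+1. \<delta> (f $$ i) * ?c i $$ n)"
    by (rule sum.mono_neutral_left) (auto simp: b)
  also have "(\<Sum>i=a..b+1. \<sigma> (f $$ (i - 1)) * ?c i $$ n) + (\<Sum>i=a..b+1. \<delta> (f $$ i) * ?c i $$ n) =
      skew_fls_mult (X_mult f) g $$ n"
    by (simp add: skew_fls_mult_nth[of a _ "b + 1"] a b X_mult_nth sigma_simps delta_simps
        distrib_right sum.distrib)
  finally show "X_mult (skew_fls_mult f g) $$ n = skew_fls_mult (X_mult f) g $$ n" .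
qed

text \<open>Inherited from \<open>X_mult\<close>, whose inverse this is.\<close>

lemma X_inv_mult_skew_fls_mult:
  "X_inv_mult (skew_fls_mult f g) = skew_fls_mult (X_inv_mult f) g"
proof -
  have "skew_fls_mult f g = X_mult (skew_fls_mult (X_inv_mult f) g)"
    by (simp add: X_mult_skew_fls_mult X_mult_X_inv_mult)
  then show ?thesis by (simp add: X_inv_mult_X_mult)
qed

lemma X_pow_mult_skew_fls_mult:
  "X_pow_mult i (skew_fls_mult f g) = skew_fls_mult (X_pow_mult i f) g"
proof -
  have "(X_mult ^^ n) (skew_fls_mult f g) = skew_fls_mult ((X_mult ^^ n) f) g"
    "(X_inv_mult ^^ n) (skew_fls_mult f g) = skew_fls_mult ((X_inv_mult ^^ n) f) g" for n
    by (induction n) (simp_all add: X_mult_skew_fls_mult X_inv_mult_skew_fls_mult)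
  then show ?thesis by (simp add: X_pow_mult_def)
qed

text \<open>Since X^i (g h) = (X^i g) h, both sides expand to one double sum over i from a to I and
  j from c to J.\<close>

lemma skew_fls_mult_assoc:
  "skew_fls_mult (skew_fls_mult f g) h = skew_fls_mult f (skew_fls_mult g h)"
proof (rule fls_eqI)
  fix n
  define a where "a = fls_subdegree f"
  have a: "\<And>i. i < a \<Longrightarrow> f $$ i = 0" by (simp add: a_def)
  let ?g = "\<lambda>i j. X_pow_mult i g $$ j" and ?h = "\<lambda>j. X_pow_mult j h $$ n"
  \<comment> \<open>The order of choice matters: J depends on h, and I on J, because only degrees up
    to J of \<open>X_pow_mult i g\<close> meet nonzero factors.\<close>
  obtain J where J: "\<And>j. J < j \<Longrightarrow> ?h j = 0"
    by (metis X_pow_mult_upper_bound order_refl)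
  obtain I where I: "\<And>i j. I < i \<Longrightarrow> j \<le> J \<Longrightarrow> ?g i j = 0"
    using X_pow_mult_upper_bound[where f = "g" and n = J] by blast
  obtain c where c: "\<And>i j. a \<le> i \<Longrightarrow> j < c \<Longrightarrow> ?g i j = 0"
    using X_pow_mult_lower_bound[where f = g and a = a] by blast
  have fg: "skew_fls_mult f g $$ j = (\<Sum>i=a..I. f $$ i * ?g i j)" if "j \<le> J" for j
    using that by (intro skew_fls_mult_nth) (auto simp: a I)
  have fg0: "skew_fls_mult f g $$ j = 0" if "j < c" for j
  proof -
    obtain b where "\<And>i. b < i \<Longrightarrow> ?g i j = 0"
      by (metis X_pow_mult_upper_bound order_refl)
    then have "skew_fls_mult f g $$ j = (\<Sum>i=a..b. f $$ i * ?g i j)"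
      by (intro skew_fls_mult_nth) (auto simp: a)
    also have "\<dots> = 0" using that by (intro sum.neutral) (auto simp: c)
    finally show ?thesis .
  qed
  have gh: "X_pow_mult i (skew_fls_mult g h) $$ n = (\<Sum>j=c..J. ?g i j * ?h j)" if "a \<le> i" for i
    unfolding X_pow_mult_skew_fls_mult using that by (intro skew_fls_mult_nth) (auto simp: c J)
  have gh0: "X_pow_mult i (skew_fls_mult g h) $$ n = 0" if "I < i" for i
  proof -
    \<comment> \<open>The bound c is available only for a \<le> i, which is not known here; hence
      the subdegree as lower limit.\<close>
    have "X_pow_mult i (skew_fls_mult g h) $$ n =
        (\<Sum>j=fls_subdegree (X_pow_mult i g)..J. ?g i j * ?h j)"
      unfolding X_pow_mult_skew_fls_mult by (intro skew_fls_mult_nth) (auto simp: J)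
    also have "\<dots> = 0" using that by (intro sum.neutral) (auto simp: I)
    finally show ?thesis .
  qed
  have "skew_fls_mult (skew_fls_mult f g) h $$ n = (\<Sum>j=c..J. skew_fls_mult f g $$ j * ?h j)"
    by (intro skew_fls_mult_nth) (auto simp: fg0 J)
  also have "\<dots> = (\<Sum>j=c..J. \<Sum>i=a..I. f $$ i * (?g i j * ?h j))"
    by (intro sum.cong) (auto simp: fg sum_distrib_right mult.assoc)
  also have "\<dots> = (\<Sum>i=a..I. \<Sum>j=c..J. f $$ i * (?g i j * ?h j))"
    by (rule sum.swap)
  also have "\<dots> = (\<Sum>i=a..I. f $$ i * X_pow_mult i (skew_fls_mult g h) $$ n)"
    by (intro sum.cong) (auto simp: gh sum_distrib_left)
  also have "\<dots> = skew_fls_mult f (skew_fls_mult g h) $$ n"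
    by (intro skew_fls_mult_nth[symmetric]) (auto simp: a gh0)
  finally show "skew_fls_mult (skew_fls_mult f g) h $$ n =
      skew_fls_mult f (skew_fls_mult g h) $$ n" .
qed

lemma skew_fls_mult_intpow_left: "skew_fls_mult (fls_shift j 1) g = X_pow_mult (- j) g"
proof (rule fls_eqI)
  fix n
  obtain b where b: "\<And>i n'. b < i \<Longrightarrow> n' \<le> n \<Longrightarrow> X_pow_mult i g $$ n' = 0"
    using X_pow_mult_upper_bound[where f = "g" and n = n] by blast
  have "skew_fls_mult (fls_shift j 1) g $$ n =
      (\<Sum>i=-j..max b (-j). (fls_shift j 1) $$ i * X_pow_mult i g $$ n)"
    by (rule skew_fls_mult_nth) (auto simp: b)
  also have "\<dots> = (\<Sum>i\<in>{-j}. (fls_shift j 1) $$ i * X_pow_mult i g $$ n)"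
    by (rule sum.mono_neutral_right) auto
  finally show "skew_fls_mult (fls_shift j 1) g $$ n = X_pow_mult (- j) g $$ n" by simp
qed

lemma skew_fls_mult_intpow_right: "skew_fls_mult f (fls_shift j 1) = fls_shift j f"
proof (rule fls_eqI)
  fix n
  \<comment> \<open>The minimum puts n + j, the only contributing index, into the range even if it
    lies below the subdegree of f.\<close>
  define a where "a = min (fls_subdegree f) (n + j)"
  have "skew_fls_mult f (fls_shift j 1) $$ n =
      (\<Sum>i=a..n+j. f $$ i * X_pow_mult i (fls_shift j 1) $$ n)"
    by (rule skew_fls_mult_nth) (auto simp: a_def X_pow_mult_intpow)
  also have "\<dots> = (\<Sum>i\<in>{n+j}. f $$ i * X_pow_mult i (fls_shift j 1) $$ n)"
    by (rule sum.mono_neutral_right) (auto simp: X_pow_mult_intpow a_def)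
  finally show "skew_fls_mult f (fls_shift j 1) $$ n = fls_shift j f $$ n"
    by (simp add: X_pow_mult_intpow)
qed

lemma monoid_skew_fls_mult: "monoid skew_fls_mult 1"
  using skew_fls_mult_intpow_left[of 0] skew_fls_mult_intpow_right[of _ 0]
  by unfold_locales (simp_all add: skew_fls_mult_assoc X_pow_mult_def)

lemma ring_structure_skew_fls_mult: "ring_structure skew_fls_mult"
  using monoid_skew_fls_mult
  by (auto simp: ring_structure_def skew_fls_mult_add_left skew_fls_mult_add_right)

section \<open>Agreement with skew polynomials and the truncation formula\<close>

lemma skew_fls_mult_fps_nth:
  assumes "\<And>i. q < i \<Longrightarrow> (X_mult ^^ i) g $$ n = 0"
  shows "skew_fls_mult (fps_to_fls s) g $$ n = (\<Sum>i=0..q. s $ i * (X_mult ^^ i) g $$ n)"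
proof -
  have "skew_fls_mult (fps_to_fls s) g $$ n =
      (\<Sum>i=int 0..int q. fps_to_fls s $$ i * X_pow_mult i g $$ n)"
    by (rule skew_fls_mult_nth) (auto simp: X_pow_mult_def assms)
  then show ?thesis
    using sum.atLeast_int_atMost_int_shift[of "\<lambda>i. s $ nat i * X_pow_mult i g $$ n" 0 q]
    by (simp add: X_pow_mult_def o_def)
qed

lemma X_mult_pow_poly_to_fls:
  "(X_mult ^^ i) (poly_to_fls p) = poly_to_fls ((skew_X_mult \<sigma> \<delta> ^^ i) p)"
proof (induction i)
  case (Suc i)
  have "X_mult (poly_to_fls q) = poly_to_fls (skew_X_mult \<sigma> \<delta> q)" for q
  proof (rule fls_eqI)
    fix n
    show "X_mult (poly_to_fls q) $$ n = poly_to_fls (skew_X_mult \<sigma> \<delta> q) $$ n"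
    proof (cases "0 < n")
      case True
      then obtain k where "n = int (Suc k)"
        by (metis Suc_pred zero_less_imp_eq_int)
      then show ?thesis
        by (simp add: X_mult_nth poly_to_fls_nth coeff_skew_X_mult[OF skew_derivation] nat_add_distrib)
    qed (auto simp: X_mult_nth poly_to_fls_nth coeff_skew_X_mult[OF skew_derivation]
        sigma_simps delta_simps)
  qed
  with Suc show ?case by simp
qed simp

lemma poly_to_fls_skew_mult:
  "poly_to_fls (skew_mult \<sigma> \<delta> p q) = skew_fls_mult (poly_to_fls p) (poly_to_fls q)"
proof (rule fls_eqI)
  fix n
  obtain b where b: "\<And>i n'. b < i \<Longrightarrow> n' \<le> n \<Longrightarrow> X_pow_mult i (poly_to_fls q) $$ n' = 0"
    using X_pow_mult_upper_bound[where f = "poly_to_fls q" and n = n] by blast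
  \<comment> \<open>Large enough for the polynomial product and the Laurent product to be sums over
    the same range.\<close>
  define N where "N = max (degree p) (nat b)"
  have "(X_mult ^^ i) (poly_to_fls q) $$ n = 0" if "N < i" for i
    using b[of "int i" n] that by (auto simp: X_pow_mult_def N_def)
  then have "skew_fls_mult (poly_to_fls p) (poly_to_fls q) $$ n =
      (\<Sum>i=0..N. coeff p i * poly_to_fls ((skew_X_mult \<sigma> \<delta> ^^ i) q) $$ n)"
    using skew_fls_mult_fps_nth[of N "poly_to_fls q" n "fps_of_poly p"]
    by (simp add: poly_to_fls_def[of p] X_mult_pow_poly_to_fls)
  also have "\<dots> = poly_to_fls (skew_mult \<sigma> \<delta> p q) $$ n"
    by (simp add: poly_to_fls_nth skew_mult_bound[OF skew_derivation, of p N] N_def coeff_sum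
        coeff_poly_lmult[OF skew_derivation] atMost_atLeast0)
  finally show "poly_to_fls (skew_mult \<sigma> \<delta> p q) $$ n =
      skew_fls_mult (poly_to_fls p) (poly_to_fls q) $$ n" ..
qed

lemma subring_via_poly_to_fls: "subring_via poly_to_fls (skew_mult \<sigma> \<delta>) skew_fls_mult"
proof -
  have "inj (poly_to_fls :: 'a poly \<Rightarrow> 'a fls)"
    by (rule injI, rule poly_eqI) (metis poly_to_fls_nth nat_int of_nat_less_0_iff)
  moreover have "additive (poly_to_fls :: 'a poly \<Rightarrow> 'a fls)"
    by (rule additive.intro, rule fls_eqI) (simp add: poly_to_fls_nth)
  ultimately show ?thesis
    using monoid_skew_mult[OF skew_derivation] monoid_skew_fls_mult
    by (auto simp: subring_via_def poly_to_fls_skew_mult poly_to_fls_one intro!: exI[of _ "[:1:]"])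
qed

lemma skew_X_pow_sum:
  "(skew_X_mult \<sigma> \<delta> ^^ k) (sum f I) = (\<Sum>i\<in>I. (skew_X_mult \<sigma> \<delta> ^^ k) (f i))"
  by (induction k) (simp_all add: skew_X_mult_sum[OF skew_derivation])

text \<open>Right multiplication by X^i is a shift and commutes with left multiplication by
  X.\<close>

lemma coeff_skew_X_pow_monom:
  "coeff ((skew_X_mult \<sigma> \<delta> ^^ k) (monom a i)) n =
    (if i \<le> n then coeff ((skew_X_mult \<sigma> \<delta> ^^ k) [:a:]) (n - i) else 0)"
proof (induction k arbitrary: n)
  case 0
  show ?case by (auto simp: coeff_pCons split: nat.split)
next
  case (Suc k)
  then show ?case
    by (auto simp: coeff_skew_X_mult[OF skew_derivation] sigma_simps delta_simps Suc_diff_le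
        le_Suc_eq split: nat.split)
qed

text \<open>X^k t_j has no coefficient up to n by the bound on k, and the factor X^j only raises
  degrees.\<close>

lemma coeff_skew_X_pow_truncation:
  assumes "skew_order_bound \<sigma> \<delta> Ob" "\<And>j. j \<le> n \<Longrightarrow> Ob n (t j) \<le> k" "i \<le> n"
  shows "coeff ((skew_X_mult \<sigma> \<delta> ^^ k) (\<Sum>j=0..n. monom (t j) j)) i = 0"
proof -
  have "coeff ((skew_X_mult \<sigma> \<delta> ^^ k) [:t j:]) (i - j) = 0" if "j \<le> n" for j
  proof -
    have "i - j \<le> n" using assms(3) by simp
    then have "coeff (skew_mult \<sigma> \<delta> (monom 1 k) [:t j:]) (i - j) = 0"
      using assms(1) assms(2)[OF that] unfolding skew_order_bound_def by blast
    then show ?thesis by (simp add: skew_mult_monom_1[OF skew_derivation])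
  qed
  then show ?thesis
    by (auto simp: skew_X_pow_sum coeff_sum coeff_skew_X_pow_monom intro!: sum.neutral)
qed

text \<open>Terms of t beyond degree n cannot reach degree n under nonnegative powers of X, and
  powers of X beyond \<open>q n\<close> are killed by the order bound.\<close>

lemma skew_fls_mult_fps:
  assumes Ob: "skew_order_bound \<sigma> \<delta> Ob"
    and q: "\<And>n i. i \<le> n \<Longrightarrow> Ob n (t $ i) \<le> q n"
  shows "skew_fls_mult (fps_to_fls s) (fps_to_fls t) =
    fps_to_fls (Abs_fps (\<lambda>n. coeff (skew_mult \<sigma> \<delta> (\<Sum>i=0..q n. monom (s $ i) i)
      (\<Sum>i=0..n. monom (t $ i) i)) n))"
proof (rule fls_eqI)
  fix k :: int
  have neg: "(X_mult ^^ i) (fps_to_fls t) $$ k = 0" if "k < 0" for i k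
    using X_pow_mult_vanishes_below[of "int i" 0 "fps_to_fls t" k] that
    by (simp add: X_pow_mult_def)
  show "skew_fls_mult (fps_to_fls s) (fps_to_fls t) $$ k =
    fps_to_fls (Abs_fps (\<lambda>n. coeff (skew_mult \<sigma> \<delta> (\<Sum>i=0..q n. monom (s $ i) i)
      (\<Sum>i=0..n. monom (t $ i) i)) n)) $$ k"
  proof (cases "k < 0")
    case True
    then show ?thesis by (simp add: skew_fls_mult_fps_nth[of 0] neg)
  next
    case False
    define n where "n = nat k"
    with False have k: "k = int n" by simp
    define p where "p = (\<Sum>i=0..n. monom (t $ i) i)"
    have "coeff p i = t $ i" if "i \<le> n" for i
      using that by (simp add: p_def coeff_sum)
    then have rest: "(fps_to_fls t - poly_to_fls p) $$ i = 0" if "i < int n + 1" for i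
      using that by (auto simp: poly_to_fls_nth)
    have trunc: "(X_mult ^^ i) (fps_to_fls t) $$ k = coeff ((skew_X_mult \<sigma> \<delta> ^^ i) p) n" for i
    proof -
      have "X_pow_mult (int i) (fps_to_fls t) =
          X_pow_mult (int i) (poly_to_fls p) + X_pow_mult (int i) (fps_to_fls t - poly_to_fls p)"
        by (simp flip: X_pow_mult_add)
      moreover have "X_pow_mult (int i) (fps_to_fls t - poly_to_fls p) $$ int n = 0"
        using rest by (intro X_pow_mult_vanishes_below[where d = "int n + 1"]) auto
      ultimately show ?thesis
        by (simp add: X_pow_mult_def X_mult_pow_poly_to_fls poly_to_fls_nth k)
    qed
    have "coeff ((skew_X_mult \<sigma> \<delta> ^^ i) p) n = 0" if "q n < i" for i
      unfolding p_def using q[of _ n] that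
      by (intro coeff_skew_X_pow_truncation[OF Ob]) (auto intro: order.trans less_imp_le)
    then have "skew_fls_mult (fps_to_fls s) (fps_to_fls t) $$ k =
        (\<Sum>i=0..q n. s $ i * coeff ((skew_X_mult \<sigma> \<delta> ^^ i) p) n)"
      by (simp add: skew_fls_mult_fps_nth[of "q n"] trunc)
    then show ?thesis
      by (simp add: k p_def[symmetric] skew_mult_sum[OF skew_derivation] coeff_sum
          skew_mult_monom[OF skew_derivation] coeff_poly_lmult[OF skew_derivation])
  qed
qed

lemma X_inv_mult_fps:
  "X_inv_mult (fps_to_fls s) = (\<Sum>k=0..m. fls_shift (int k + 1)
      (fps_to_fls (fps_map (\<sigma>' \<circ> (\<delta>' ^^ k)) s)))"
  by (rule fls_eqI)
     (auto simp: X_inv_mult_nth fls_nth_sum fps_map_def sigma'_0 delta'_pow_0 add_ac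
       intro!: sum.cong)

lemma skew_laurent_structure_skew_fls_mult:
  assumes "skew_order_bound \<sigma> \<delta> Ob"
  shows "skew_laurent_structure \<sigma> \<delta> Ob m skew_fls_mult"
proof -
  have "skew_fls_mult (fps_to_fls s) (fps_to_fls t) = fps_to_fls (Abs_fps (\<lambda>n.
          coeff (skew_mult \<sigma> \<delta> (\<Sum>i=0..q n. monom (s $ i) i) (\<Sum>i=0..n. monom (t $ i) i)) n))"
    if "\<forall>n. (MAX i\<in>{0..n}. Ob n (t $ i)) \<le> q n" for s t q
    using that by (intro skew_fls_mult_fps[OF assms]) auto
  moreover have "X_pow_mult (- 1) (fps_to_fls s) = (\<Sum>k=0..m. fls_shift (int k + 1)
      (fps_to_fls (fps_map (\<sigma>' \<circ> (\<delta>' ^^ k)) s)))" for s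
    by (simp add: X_pow_mult_def X_inv_mult_fps)
  ultimately show ?thesis
    unfolding skew_laurent_structure_def
    by (auto simp: ring_structure_skew_fls_mult subring_via_poly_to_fls fps_shift_fls_def
        skew_fls_mult_intpow_left skew_fls_mult_intpow_right)
qed

section \<open>Uniqueness of the Laurent product\<close>

lemma X_inv_mult_shift: "X_inv_mult (fls_shift j f) = fls_shift j (X_inv_mult f)"
  by (rule fls_eqI) (simp add: X_inv_mult_nth add_ac)

text \<open>The rules alone give (s X^(-n)) g = s (t X^(-k)) = (s t) X^(-k). The last expression
  involves M only on power series, where the second rule prescribes it.\<close>

lemma skew_laurent_structure_shift:
  assumes M: "skew_laurent_structure \<sigma> \<delta> Ob m M"
    and g: "(X_inv_mult ^^ n) g = fls_shift k (fps_to_fls t)"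
  shows "M (fls_shift (int n) (fps_to_fls s)) g = fls_shift k (M (fps_to_fls s) (fps_to_fls t))"
proof -
  from M obtain e where "monoid (skew_mult \<sigma> \<delta>) e" "monoid M (poly_to_fls e)"
    unfolding skew_laurent_structure_def subring_via_def by blast
  \<comment> \<open>The subring condition yields only some common identity; uniqueness of the
    identity of the skew polynomials makes it the constant 1.\<close>
  moreover from this have "e = [:1:]"
    by (metis monoid.left_neutral monoid.right_neutral monoid_skew_mult[OF skew_derivation])
  ultimately have mon: "monoid M 1" by (simp add: poly_to_fls_one)
  then have assoc: "M (M x y) z = M x (M y z)" for x y z
    by (simp add: monoid_def semigroup_def)
  have shift: "M (fps_to_fls u) (fls_shift j 1) = fls_shift j (fps_to_fls u)" for u j
  proof -
    have "M (fps_to_fls u) (fls_X_intpow (- j)) = fps_shift_fls (- j) u"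
      using M unfolding skew_laurent_structure_def by blast
    then show ?thesis by (simp add: fps_shift_fls_def)
  qed
  have Xinv_fps: "M (fls_shift 1 1) (fps_to_fls u) = X_inv_mult (fps_to_fls u)" for u
  proof -
    have "M (fls_X_intpow (- 1)) (fps_to_fls u) = (\<Sum>k=0..m.
        M (fps_to_fls (fps_map (\<sigma>' \<circ> (\<delta>' ^^ k)) u)) (fls_X_intpow (- 1 - int k)))"
      using M unfolding skew_laurent_structure_def by blast
    then show ?thesis by (simp add: X_inv_mult_fps shift)
  qed
  \<comment> \<open>The third rule has a power series on the right, so X^(-j) is written as X
    X^(-j-1) and X^(-1) X = 1 is used, X being a power series.\<close>
  have Xinv_shift: "M (fls_shift 1 1) (fls_shift j 1) = fls_shift (j + 1) 1" for j
  proof -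
    have X: "fls_shift (- 1) 1 = fps_to_fls (fps_X :: 'a fps)"
      by (simp add: fls_X_conv_shift_1)
    have "M (fls_shift 1 1) (fls_shift (- 1) 1) = X_inv_mult (fls_shift (- 1) 1)"
      unfolding X by (rule Xinv_fps)
    then have "M (fls_shift 1 1) (M (fls_shift (- 1) 1) (fls_shift (j + 1) 1)) = fls_shift (j + 1) 1"
      by (simp add: X_inv_mult_intpow monoid.left_neutral[OF mon] flip: assoc)
    also have "M (fls_shift (- 1) 1) (fls_shift (j + 1) 1) = fls_shift j 1"
      unfolding X shift by (rule fls_eqI) auto
    finally show ?thesis .
  qed
  have Xpow_shift: "M (fls_shift (int i) 1) (fls_shift j 1) = fls_shift (int i + j) 1" for i j
  proof (induction i)
    case 0
    show ?case by (simp add: monoid.left_neutral[OF mon])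
  next
    case (Suc i)
    have "M (fls_shift (int (Suc i)) 1) (fls_shift j 1) =
        M (M (fls_shift 1 1) (fls_shift (int i) 1)) (fls_shift j 1)"
      by (simp add: Xinv_shift add.commute)
    also have "\<dots> = fls_shift (int (Suc i) + j) 1"
      by (simp only: assoc Suc) (simp add: Xinv_shift add_ac)
    finally show ?case .
  qed
  \<comment> \<open>The first rule has a power series on the left; a general f is u X^(-i), and the
    two powers of X are merged by \<open>Xpow_shift\<close>.\<close>
  have shift': "M f (fls_shift j 1) = fls_shift j f" for f j
  proof -
    obtain i u where f: "f = fls_shift (int i) (fps_to_fls u)"
      by (rule fls_eq_shift_fps_to_fls)
    have "M f (fls_shift j 1) = M (fps_to_fls u) (M (fls_shift (int i) 1) (fls_shift j 1))"
      by (simp add: f shift flip: assoc)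
    then show ?thesis by (simp add: Xpow_shift shift f)
  qed
  have Xinv: "M (fls_shift 1 1) f = X_inv_mult f" for f
  proof -
    obtain i u where f: "f = fls_shift (int i) (fps_to_fls u)"
      by (rule fls_eq_shift_fps_to_fls)
    have "M (fls_shift 1 1) f = M (M (fls_shift 1 1) (fps_to_fls u)) (fls_shift (int i) 1)"
      by (simp add: assoc shift f)
    then show ?thesis by (simp add: Xinv_fps shift' f X_inv_mult_shift)
  qed
  have Xpow: "M (fls_shift (int i) 1) f = (X_inv_mult ^^ i) f" for i f
  proof (induction i)
    case 0
    show ?case by (simp add: monoid.left_neutral[OF mon])
  next
    case (Suc i)
    have "M (fls_shift (int (Suc i)) 1) f = M (M (fls_shift 1 1) (fls_shift (int i) 1)) f"
      by (simp add: Xinv_shift add.commute)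
    also have "\<dots> = X_inv_mult ((X_inv_mult ^^ i) f)"
      by (simp only: assoc Suc) (rule Xinv)
    finally show ?case by simp
  qed
  have "M (fls_shift (int n) (fps_to_fls s)) g = M (fps_to_fls s) (M (fls_shift (int n) 1) g)"
    by (simp add: shift flip: assoc)
  also have "\<dots> = M (fps_to_fls s) (M (fps_to_fls t) (fls_shift k 1))"
    by (simp add: Xpow g shift)
  also have "\<dots> = fls_shift k (M (fps_to_fls s) (fps_to_fls t))"
    unfolding assoc[symmetric] by (rule shift')
  finally show ?thesis .
qed

lemma skew_laurent_structure_unique:
  assumes Ob: "skew_order_bound \<sigma> \<delta> Ob"
    and M: "skew_laurent_structure \<sigma> \<delta> Ob m M"
  shows "M = skew_fls_mult"
proof (intro ext)
  fix f g :: "'a fls"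
  obtain n s where f: "f = fls_shift (int n) (fps_to_fls s)"
    by (rule fls_eq_shift_fps_to_fls)
  obtain k t where g: "(X_inv_mult ^^ n) g = fls_shift (int k) (fps_to_fls t)"
    by (rule fls_eq_shift_fps_to_fls)
  define q where "q n = (MAX i\<in>{0..n}. Ob n (t $ i))" for n
  have fps: "K (fps_to_fls s) (fps_to_fls t) = fps_to_fls (Abs_fps (\<lambda>n.
          coeff (skew_mult \<sigma> \<delta> (\<Sum>i=0..q n. monom (s $ i) i) (\<Sum>i=0..n. monom (t $ i) i)) n))"
    if K: "skew_laurent_structure \<sigma> \<delta> Ob m K"
      and q: "\<forall>n. (MAX i\<in>{0..n}. Ob n (t $ i)) \<le> q n" for K q
    using K unfolding skew_laurent_structure_def by (elim conjE) (use q in blast)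
  have "M (fps_to_fls s) (fps_to_fls t) = skew_fls_mult (fps_to_fls s) (fps_to_fls t)"
    using fps[of M q] fps[of skew_fls_mult q] M skew_laurent_structure_skew_fls_mult[OF Ob]
    by (simp add: q_def)
  then show "M f g = skew_fls_mult f g"
    unfolding f
    by (simp add: skew_laurent_structure_shift[OF M g]
        skew_laurent_structure_shift[OF skew_laurent_structure_skew_fls_mult[OF Ob] g])
qed

section \<open>Skew power series\<close>

definition restricted_skew_mult :: "'a fps \<Rightarrow> 'a fps \<Rightarrow> 'a fps" where
  "restricted_skew_mult s t = fls_regpart (skew_fls_mult (fps_to_fls s) (fps_to_fls t))"

text \<open>The truncation formula exhibits the product as a power series, so taking the regular
  part loses nothing.\<close>

lemma fps_to_fls_restricted_skew_mult:
  "fps_to_fls (restricted_skew_mult s t) = skew_fls_mult (fps_to_fls s) (fps_to_fls t)"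
proof -
  obtain Ob where Ob: "skew_order_bound \<sigma> \<delta> Ob"
    using skew_order_bound_exists[OF skew_derivation nilpotent_delta] by blast
  have "Ob n (t $ i) \<le> (MAX i\<in>{0..n}. Ob n (t $ i))" if "i \<le> n" for i n
    using that by (intro Max_ge) auto
  from skew_fls_mult_fps[OF Ob this] show ?thesis
    by (simp add: restricted_skew_mult_def)
qed

lemma monoid_restricted_skew_mult: "monoid restricted_skew_mult 1"
proof -
  interpret monoid skew_fls_mult 1 by (rule monoid_skew_fls_mult)
  show ?thesis
    by unfold_locales
      (simp_all add: fps_to_fls_restricted_skew_mult assoc flip: fps_to_fls_eq_iff)
qed

lemma subring_via_fps_to_fls: "subring_via fps_to_fls restricted_skew_mult skew_fls_mult"
  unfolding subring_via_def
  using monoid_restricted_skew_mult monoid_skew_fls_mult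
  by (auto simp: inj_def additive_def fps_to_fls_restricted_skew_mult intro!: exI[of _ 1])

lemma subring_via_fps_of_poly:
  "subring_via fps_of_poly (skew_mult \<sigma> \<delta>) restricted_skew_mult"
proof -
  have "fps_of_poly (skew_mult \<sigma> \<delta> p q) = restricted_skew_mult (fps_of_poly p) (fps_of_poly q)" for p q
    unfolding fps_to_fls_eq_iff[symmetric] fps_to_fls_restricted_skew_mult
    using poly_to_fls_skew_mult[of p q] by (simp only: poly_to_fls_def)
  moreover have "fps_of_poly [:1:] = (1 :: 'a fps)"
    by (simp add: fps_of_poly_const)
  ultimately show ?thesis
    unfolding subring_via_def
    using monoid_restricted_skew_mult monoid_skew_mult[OF skew_derivation]
    by (auto simp: inj_def additive_def fps_of_poly_add intro!: exI[of _ "[:1:]"])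
qed

section \<open>Reasonable ring structures on power series\<close>

lemma skew_fls_mult_const_nth: "skew_fls_mult (fls_const a) g $$ n = a * g $$ n"
proof -
  obtain b where b: "\<And>i n'. b < i \<Longrightarrow> n' \<le> n \<Longrightarrow> X_pow_mult i g $$ n' = 0"
    using X_pow_mult_upper_bound[where f = g and n = n] by blast
  have "skew_fls_mult (fls_const a) g $$ n =
      (\<Sum>i=0..max b 0. fls_const a $$ i * X_pow_mult i g $$ n)"
    by (rule skew_fls_mult_nth) (auto simp: b)
  also have "\<dots> = (\<Sum>i\<in>{0}. fls_const a $$ i * X_pow_mult i g $$ n)"
    by (rule sum.mono_neutral_right) auto
  finally show ?thesis by (simp add: X_pow_mult_def)
qed

lemma reasonable_restricted_skew_mult: "reasonable restricted_skew_mult"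
proof -
  have const: "restricted_skew_mult (fps_const a) s = fps_map (\<lambda>c. a * c) s" for a s
    by (rule fps_ext) (simp add: restricted_skew_mult_def skew_fls_mult_const_nth fps_map_def)
  have "ring_structure restricted_skew_mult"
    unfolding ring_structure_def using monoid_restricted_skew_mult
    by (auto simp: fps_to_fls_restricted_skew_mult skew_fls_mult_add_left skew_fls_mult_add_right
        simp flip: fps_to_fls_eq_iff)
  moreover have "subring_via fps_const (*) restricted_skew_mult"
  proof -
    have "monoid ((*) :: 'a \<Rightarrow> 'a \<Rightarrow> 'a) 1" by unfold_locales (simp_all add: mult.assoc)
    moreover have "fps_const (a * b) = fps_map (\<lambda>c. a * c) (fps_const b)" for a b :: 'a
      by (rule fps_ext) (simp add: fps_map_def)
    ultimately show ?thesis
      unfolding subring_via_def using monoid_restricted_skew_mult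
      by (auto simp: const inj_def additive_def intro!: exI[of _ 1])
  qed
  moreover have "restricted_skew_mult s fps_X =
      Abs_fps (\<lambda>i. case i of 0 \<Rightarrow> 0 | Suc j \<Rightarrow> s $ j)" for s
    by (rule fps_ext)
      (auto simp: restricted_skew_mult_def fls_X_conv_shift_1 skew_fls_mult_intpow_right
        split: nat.split)
  ultimately show ?thesis by (simp add: reasonable_def const)
qed

text \<open>Associativity takes the place of continuity: the tails of s and t are multiples u
  X^(q+1) and z X^(n+1), and both drop out of the coefficient of X^n.\<close>

lemma reasonable_nth:
  assumes N: "reasonable N" "subring_via fps_of_poly (skew_mult \<sigma> \<delta>) N"
    and Ob: "skew_order_bound \<sigma> \<delta> Ob"
    and q: "\<And>i. i \<le> n \<Longrightarrow> Ob n (t $ i) \<le> q"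
  shows "N s t $ n =
    coeff (skew_mult \<sigma> \<delta> (\<Sum>i=0..q. monom (s $ i) i) (\<Sum>i=0..n. monom (t $ i) i)) n"
proof -
  from N(1) obtain e where "monoid N e"
    and addl: "\<And>x y z. N (x + y) z = N x z + N y z"
    and addr: "\<And>x y z. N x (y + z) = N x y + N x z"
    and X: "\<And>s. N s fps_X = Abs_fps (\<lambda>i. case i of 0 \<Rightarrow> 0 | Suc j \<Rightarrow> s $ j)"
    unfolding reasonable_def ring_structure_def by blast
  then have assoc: "N (N x y) z = N x (N y z)" for x y z
    by (simp add: monoid_def semigroup_def)
  from N(2) obtain d where poly: "\<And>x y. fps_of_poly (skew_mult \<sigma> \<delta> x y) = N (fps_of_poly x) (fps_of_poly y)"
    and d: "monoid (skew_mult \<sigma> \<delta>) d" "monoid N (fps_of_poly d)"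
    unfolding subring_via_def by blast
  from d(1) have "d = [:1:]"
    by (metis monoid.left_neutral monoid.right_neutral monoid_skew_mult[OF skew_derivation])
  with d(2) have one: "N x (fps_of_poly (monom 1 0)) = x" for x
    by (simp add: monom_0 monoid.right_neutral)
  have Xpow: "N x (fps_of_poly (monom 1 k)) $ i = (if i < k then 0 else x $ (i - k))" for x k i
  proof (induction k arbitrary: i)
    case 0
    show ?case by (simp only: one) simp
  next
    case (Suc k)
    have "monom 1 (Suc k) = skew_mult \<sigma> \<delta> (monom 1 k) (monom 1 (Suc 0))"
      using skew_X_pow_monom[OF skew_derivation, of k "Suc 0"]
      by (simp add: skew_mult_monom_1[OF skew_derivation])
    moreover have "fps_of_poly (monom 1 (Suc 0)) = (fps_X :: 'a fps)"
      by (rule fps_ext) auto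
    ultimately have "N x (fps_of_poly (monom 1 (Suc k))) = N (N x (fps_of_poly (monom 1 k))) fps_X"
      by (simp add: poly assoc)
    then show ?case by (simp add: X Suc split: nat.split)
  qed
  \<comment> \<open>Such a y is z X^(n+1), so x y = (x z) X^(n+1) has no coefficient up to
    n.\<close>
  have vanish: "N x y $ n = 0" if "\<And>i. i \<le> n \<Longrightarrow> y $ i = 0" for x y
  proof -
    have "y = N (fps_shift (Suc n) y) (fps_of_poly (monom 1 (Suc n)))"
      using that by (intro fps_ext) (auto simp: Xpow)
    then have "N x y = N (N x (fps_shift (Suc n) y)) (fps_of_poly (monom 1 (Suc n)))"
      by (metis assoc)
    then show ?thesis by (simp add: Xpow)
  qed
  define P where "P = (\<Sum>i=0..q. monom (s $ i) i)"
  define Q where "Q = (\<Sum>i=0..n. monom (t $ i) i)"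
  define u where "u = fps_shift (Suc q) s"
  have P: "coeff P i = (if i \<le> q then s $ i else 0)" for i by (simp add: P_def coeff_sum)
  have Q: "coeff Q i = (if i \<le> n then t $ i else 0)" for i by (simp add: Q_def coeff_sum)
  have s: "s = fps_of_poly P + N u (fps_of_poly (monom 1 (Suc q)))"
    by (rule fps_ext) (auto simp: Xpow P u_def)
  \<comment> \<open>As q + 1 exceeds the order bounds of all coefficients of Q, X^(q+1) Q starts
    beyond degree n, and \<open>vanish\<close> removes the contribution of u.\<close>
  have "N (fps_of_poly (monom 1 (Suc q))) (fps_of_poly Q) $ i = 0" if "i \<le> n" for i
    using that q
    by (simp add: skew_mult_monom_1[OF skew_derivation] Q_def le_SucI
        coeff_skew_X_pow_truncation[OF Ob] del: funpow.simps flip: poly)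
  then have "N u (N (fps_of_poly (monom 1 (Suc q))) (fps_of_poly Q)) $ n = 0"
    by (rule vanish)
  then have "N s (fps_of_poly Q) $ n = coeff (skew_mult \<sigma> \<delta> P Q) n"
    by (subst s) (simp add: addl assoc flip: poly)
  moreover have "N s t = N s (fps_of_poly Q) + N s (t - fps_of_poly Q)"
    by (simp flip: addr)
  moreover have "N s (t - fps_of_poly Q) $ n = 0"
    by (rule vanish) (simp add: Q)
  ultimately show ?thesis by (simp add: P_def Q_def)
qed

text \<open>By \<open>reasonable_nth\<close> all candidates have the same coefficients, so the
  definite description denotes this product.\<close>

lemma skew_fps_mult_eq: "skew_fps_mult \<sigma> \<delta> = restricted_skew_mult"
  unfolding skew_fps_mult_def
proof (rule the_equality)
  show "reasonable restricted_skew_mult \<and> subring_via fps_of_poly (skew_mult \<sigma> \<delta>) restricted_skew_mult"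
    by (simp add: reasonable_restricted_skew_mult subring_via_fps_of_poly)
next
  fix N assume N: "reasonable N \<and> subring_via fps_of_poly (skew_mult \<sigma> \<delta>) N"
  obtain Ob where Ob: "skew_order_bound \<sigma> \<delta> Ob"
    using skew_order_bound_exists[OF skew_derivation nilpotent_delta] by blast
  show "N = restricted_skew_mult"
  proof (intro ext fps_ext)
    fix s t n
    have "Ob n (t $ i) \<le> (MAX i\<in>{0..n}. Ob n (t $ i))" if "i \<le> n" for i
      using that by (intro Max_ge) auto
    note eq = reasonable_nth[OF _ _ Ob this]
    show "N s t $ n = restricted_skew_mult s t $ n"
      using N eq eq[OF reasonable_restricted_skew_mult subring_via_fps_of_poly] by simp
  qed
qed

end

theorem theorem2p17:
  fixes \<sigma> \<delta> :: "'a::{ring,monoid_mult} \<Rightarrow> 'a"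
    and Ob :: "nat \<Rightarrow> 'a \<Rightarrow> nat"
    and m :: nat
  assumes "left_skew_derivation \<sigma> \<delta>"
    and "bij \<sigma>"
    and "locally_nilpotent \<delta>"
    and "1 \<le> m" and "\<forall>a. (skew_delta' \<sigma> \<delta> ^^ m) a = 0"
    and "skew_order_bound \<sigma> \<delta> Ob"
  shows "(\<exists>!M. skew_laurent_structure \<sigma> \<delta> Ob m M) \<and>
         (\<forall>M. skew_laurent_structure \<sigma> \<delta> Ob m M \<longrightarrow>
              subring_via fps_to_fls (skew_fps_mult \<sigma> \<delta>) M)"
proof -
  interpret nilpotent_skew_derivation \<sigma> \<delta> m
    using assms by unfold_locales
  note Ob = \<open>skew_order_bound \<sigma> \<delta> Ob\<close>
  have "subring_via fps_to_fls (skew_fps_mult \<sigma> \<delta>) skew_fls_mult"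
    by (simp add: skew_fps_mult_eq subring_via_fps_to_fls)
  then show ?thesis
    using skew_laurent_structure_skew_fls_mult[OF Ob] skew_laurent_structure_unique[OF Ob]
    by blast
qed

end
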